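(* Let $G$ be an abelian topological group. Then: (i) $\mathcal P(G)\in\{\emptyset,\mathcal B^*,\mathcal W^*,\mathcal W_\infty\}$; (ii) $\mathcal P_C(G)\in\{\emptyset,\mathcal B^*,\mathcal W^*,\mathcal W_\infty\}$.
   Context: All topological groups are Hausdorff; $\mathbb N=\{0,1,2,\dots\}$; $\omega$ is the first infinite ordinal and $\omega+1=\mathbb N\cup\{\omega\}$, with $n<\omega$ for all $n\in\mathbb N$. $\mathcal W_\infty$ is the set of all functions $f:\mathbb N\to(\omega+1)\setminus\{0\}$; $\mathcal W$ is the set of those $f\in\mathcal W_\infty$ with $f(n)\ne\omega$ for all $n$; $\mathcal B=\{f\in\mathcal W:\exists k\in\mathbb N\ \forall n\in\mathbb N\ f(n)\le k\}$. For $f,g\in\mathcal W_\infty$, $f=^*g$ means that there is $i\in\mathbb N$ with $f(n)=g(n)$ for all $n\ge i$. For $\mathcal A\subseteq\mathcal W_\infty$, $\mathcal A^*=\{g\in\mathcal W_\infty: g=^*f\text{ for some }f\in\mathcal A\}$. A sequence $\{x_n\}$ in an abelian topological group (written additively) is Cauchy if for every neighbourhood $U$ of $0$ there is $k$ with $x_m-x_l\in U$ for all $l,m\ge k$. A sequence $\{b_n:n\in\mathbb N\}$ in $G$ is summable (Cauchy summable) if $\{\sum_{n=0}^m b_n:m\in\mathbb N\}$ converges to some element of $G$ (respectively, is Cauchy). For $f\in\mathcal W_\infty$, a sequence $\{a_n:n\in\mathbb N\}$ in $G$ is $f$-summable ($f$-Cauchy summable) if it is faithfully indexed ($a_n\neq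 a_m$ for $n\ne m$) and $\{z(n)a_n:n\in\mathbb N\}$ is summable (respectively, Cauchy summable) for every $z:\mathbb N\to\mathbb Z$ with $|z(n)|\le f(n)$ for all $n$. $\mathcal P(G)=\{f\in\mathcal W_\infty: G\text{ contains an }f\text{-summable sequence}\}$ and $\mathcal P_C(G)=\{f\in\mathcal W_\infty: G\text{ contains an }f\text{-Cauchy summable sequence}\}$. *)

theory Defs
  imports Complex_Main "HOL-Library.Extended_Nat"
begin

text \<open>The ordinal \<open>\<omega> + 1\<close> is rendered by \<^typ>\<open>enat\<close>, with \<open>\<infinity>\<close> in the role of \<open>\<omega>\<close>.\<close>

definition W_inf :: "(nat \<Rightarrow> enat) set" where
  "W_inf = {f. \<forall>n. f n \<noteq> 0}"

definition W_fin :: "(nat \<Rightarrow> enat) set" where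
  "W_fin = {f \<in> W_inf. \<forall>n. f n \<noteq> \<infinity>}"

definition W_bdd :: "(nat \<Rightarrow> enat) set" where
  "W_bdd = {f \<in> W_fin. \<exists>k::nat. \<forall>n. f n \<le> enat k}"

definition eq_star :: "(nat \<Rightarrow> enat) \<Rightarrow> (nat \<Rightarrow> enat) \<Rightarrow> bool" (infix "=\<^sup>*" 50) where
  "f =\<^sup>* g \<longleftrightarrow> (\<exists>i. \<forall>n\<ge>i. f n = g n)"

definition star_closure :: "(nat \<Rightarrow> enat) set \<Rightarrow> (nat \<Rightarrow> enat) set" where
  "star_closure A = {g \<in> W_inf. \<exists>f\<in>A. g =\<^sup>* f}"

definition int_mult :: "int \<Rightarrow> 'a::ab_group_add \<Rightarrow> 'a" where
  "int_mult k x = (if 0 \<le> k then (\<Sum>i<nat k. x) else - (\<Sum>i<nat (- k). x))"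

text \<open>The library predicate \<^const>\<open>Cauchy\<close> needs a type of class \<^class>\<open>uniform_space\<close>. A
  topological abelian group carries no uniformity in the type class hierarchy, so the Cauchy
  condition is expressed by neighbourhoods of \<open>0\<close>.\<close>

definition group_Cauchy :: "(nat \<Rightarrow> 'a::topological_ab_group_add) \<Rightarrow> bool" where
  "group_Cauchy x \<longleftrightarrow>
     (\<forall>U. (\<forall>\<^sub>F y in nhds 0. y \<in> U) \<longrightarrow> (\<exists>k. \<forall>l\<ge>k. \<forall>m\<ge>k. x m - x l \<in> U))"

definition Cauchy_summable :: "(nat \<Rightarrow> 'a::topological_ab_group_add) \<Rightarrow> bool" where
  "Cauchy_summable b \<longleftrightarrow> group_Cauchy (\<lambda>m. \<Sum>n\<le>m. b n)"

definition f_summable :: "(nat \<Rightarrow> enat) \<Rightarrow> (nat \<Rightarrow> 'a::topological_ab_group_add) \<Rightarrow> bool" where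
  "f_summable f a \<longleftrightarrow> inj a \<and>
     (\<forall>z::nat \<Rightarrow> int. (\<forall>n. enat (nat \<bar>z n\<bar>) \<le> f n) \<longrightarrow> summable (\<lambda>n. int_mult (z n) (a n)))"

definition f_Cauchy_summable :: "(nat \<Rightarrow> enat) \<Rightarrow> (nat \<Rightarrow> 'a::topological_ab_group_add) \<Rightarrow> bool" where
  "f_Cauchy_summable f a \<longleftrightarrow> inj a \<and>
     (\<forall>z::nat \<Rightarrow> int. (\<forall>n. enat (nat \<bar>z n\<bar>) \<le> f n) \<longrightarrow> Cauchy_summable (\<lambda>n. int_mult (z n) (a n)))"

text \<open>The group \<open>G\<close> is the type \<open>'a\<close>, passed as \<open>TYPE('a)\<close>.\<close>

definition P_set :: "'a::{topological_ab_group_add, t2_space} itself \<Rightarrow> (nat \<Rightarrow> enat) set" where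
  "P_set G = {f \<in> W_inf. \<exists>a::nat \<Rightarrow> 'a. f_summable f a}"

definition PC_set :: "'a::{topological_ab_group_add, t2_space} itself \<Rightarrow> (nat \<Rightarrow> enat) set" where
  "PC_set G = {f \<in> W_inf. \<exists>a::nat \<Rightarrow> 'a. f_Cauchy_summable f a}"

end

(* Both families are stable under modifying f at finitely many places and under passing to
   subsequences of the witness a.  Any f-summable sequence is summable against all coefficients in
   {-1,0,1}, hence, by adding, against all bounded coefficients.  If f is not almost bounded, it
   dominates any prescribed finite-valued h along a subsequence; if f takes the value infinity
   infinitely often, it dominates everything along a subsequence. *)
theory Submission
  imports Defs
begin

section \<open>Integer multiples in an abelian group\<close>

lemma int_mult_0 [simp]: "int_mult 0 x = 0"
  by (simp add: int_mult_def)

lemma int_mult_add_1: "int_mult (k + 1) x = int_mult k x + x"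
proof -
  \<comment> \<open>\<open>int_mult\<close> changes branch at 0, so the step from -1 to 0 is
    isolated; in the other two cases \<open>k\<close> and \<open>k + 1\<close> lie in the same
    branch.\<close>
  consider "k \<ge> 0" | "k = -1" | "k < -1" by linarith
  then show ?thesis
  proof cases
    case 1
    then have "nat (k + 1) = Suc (nat k)" by simp
    with 1 show ?thesis by (simp add: int_mult_def)
  next
    case 2
    then show ?thesis by (simp add: int_mult_def)
  next
    case 3
    then have "nat (- k) = Suc (nat (- (k + 1)))" by simp
    with 3 show ?thesis by (simp add: int_mult_def)
  qed
qed

lemma int_mult_add: "int_mult (k + l) x = int_mult k x + int_mult l x"
proof (induction l rule: int_induct[where k = 0])
  case base
  then show ?case by simp
next
  case (step1 l)
  then show ?case
    using int_mult_add_1[of "k + l" x] int_mult_add_1[of l x] by (simp add: algebra_simps)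
next
  case (step2 l)
  then show ?case
    using int_mult_add_1[of "k + (l - 1)" x] int_mult_add_1[of "l - 1" x]
    by (simp add: algebra_simps)
qed

section \<open>Membership in the star closures\<close>

lemma star_closure_W_bddI:
  assumes "f \<in> W_inf" and "\<And>n. n \<ge> i \<Longrightarrow> f n \<le> enat k"
  shows "f \<in> star_closure W_bdd"
proof -
  \<comment> \<open>The head is replaced by 1, since functions in \<open>W_inf\<close> may not take
    the value 0; this is why the bound becomes \<open>max k 1\<close>.\<close>
  let ?g = "\<lambda>n. if n \<ge> i then f n else 1"
  have "?g n \<le> enat (max k 1)" for n
    using assms(2)[of n] by (auto simp: one_enat_def intro: order_trans)
  moreover have "?g n \<noteq> \<infinity>" for n
    using assms(2)[of n] by (cases "f n") (auto simp: one_enat_def)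
  moreover have "?g \<in> W_inf"
    using assms(1) by (simp add: W_inf_def)
  ultimately have "?g \<in> W_bdd"
    unfolding W_bdd_def W_fin_def by blast
  moreover have "f =\<^sup>* ?g"
    by (auto simp: eq_star_def)
  ultimately show ?thesis
    using assms(1) by (auto simp: star_closure_def)
qed

lemma star_closure_W_finI:
  assumes "f \<in> W_inf" and "\<And>n. n \<ge> i \<Longrightarrow> f n \<noteq> \<infinity>"
  shows "f \<in> star_closure W_fin"
proof -
  let ?g = "\<lambda>n. if n \<ge> i then f n else 1"
  have "?g \<in> W_fin"
    using assms by (auto simp: W_fin_def W_inf_def simp del: not_infinity_eq)
  moreover have "f =\<^sup>* ?g"
    by (auto simp: eq_star_def)
  ultimately show ?thesis
    using assms(1) by (auto simp: star_closure_def)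
qed

section \<open>Choosing and summing along subsequences\<close>

text \<open>The indices are chosen recursively: requiring the next one to be at least
  \<open>Suc (r j)\<close> forces strict growth, while the requirement may vary with
  \<open>j\<close>.\<close>

lemma strict_mono_choice:
  fixes Q :: "nat \<Rightarrow> nat \<Rightarrow> bool"
  assumes "\<And>j i. \<exists>n\<ge>i. Q j n"
  obtains r where "strict_mono r" and "\<And>j. Q j (r j)"
proof -
  have "\<exists>r. \<forall>j. Q j (r j) \<and> r j < r (Suc j)"
    using assms by (intro dependent_nat_choice) (auto simp: Suc_le_eq[symmetric])
  then show thesis
    using that by (auto simp: strict_mono_Suc_iff)
qed

lemma sum_subsequence:
  fixes r :: "nat \<Rightarrow> nat" and b :: "nat \<Rightarrow> 'a::comm_monoid_add"
  assumes "strict_mono r" and "\<And>n. n \<notin> range r \<Longrightarrow> b n = 0"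
  shows "(\<Sum>j\<le>m. b (r j)) = (\<Sum>n\<le>r m. b n)"
proof -
  have "(\<Sum>j\<le>m. b (r j)) = sum b (r ` {..m})"
    using strict_mono_imp_inj_on[OF assms(1)]
    by (subst sum.reindex) (auto intro: inj_on_subset)
  also have "\<dots> = (\<Sum>n\<le>r m. b n)"
  proof (rule sum.mono_neutral_left)
    show "r ` {..m} \<subseteq> {..r m}"
      using assms(1) by (auto simp: strict_mono_less_eq)
    show "\<forall>n\<in>{..r m} - r ` {..m}. b n = 0"
    proof
      fix n assume n: "n \<in> {..r m} - r ` {..m}"
      then have "n \<notin> range r"
        using assms(1) by (auto simp: strict_mono_less_eq)
      then show "b n = 0"
        by (rule assms(2))
    qed
  qed simp
  finally show ?thesis .
qed

section \<open>Admissible bounds for an abstract condition on partial sums\<close>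

text \<open>\<open>C\<close> abstracts the two conditions on partial sums: convergence and being Cauchy.\<close>

locale sequence_property =
  fixes C :: "(nat \<Rightarrow> 'a::ab_group_add) \<Rightarrow> bool"
  assumes add: "C x \<Longrightarrow> C y \<Longrightarrow> C (\<lambda>n. x n + y n)"
    and eventually_const: "(\<And>n. n \<ge> k \<Longrightarrow> x n = c) \<Longrightarrow> C x"
    and subsequence: "C x \<Longrightarrow> strict_mono r \<Longrightarrow> C (x \<circ> r)"
begin

definition C_sums :: "(nat \<Rightarrow> int) \<Rightarrow> (nat \<Rightarrow> 'a) \<Rightarrow> bool" where
  "C_sums z a \<longleftrightarrow> C (\<lambda>m. \<Sum>n\<le>m. int_mult (z n) (a n))"

text \<open>Becomes \<open>f_summable\<close> when \<open>C\<close> is \<open>convergent\<close>,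
  and \<open>f_Cauchy_summable\<close> when \<open>C\<close> is \<open>group_Cauchy\<close>.\<close>

definition f_C_sums :: "(nat \<Rightarrow> enat) \<Rightarrow> (nat \<Rightarrow> 'a) \<Rightarrow> bool" where
  "f_C_sums f a \<longleftrightarrow> inj a \<and> (\<forall>z. (\<forall>n. enat (nat \<bar>z n\<bar>) \<le> f n) \<longrightarrow> C_sums z a)"

definition P :: "(nat \<Rightarrow> enat) set" where
  "P = {f \<in> W_inf. \<exists>a. f_C_sums f a}"

lemma C_sums_add:
  assumes "C_sums y a" and "C_sums z a"
  shows "C_sums (\<lambda>n. y n + z n) a"
  using add[OF assms[unfolded C_sums_def]]
  by (simp add: C_sums_def int_mult_add sum.distrib)

lemma C_sums_finite_support:
  assumes "\<And>n. n \<ge> i \<Longrightarrow> z n = 0"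
  shows "C_sums z a"
  unfolding C_sums_def
proof (rule eventually_const)
  fix m assume "m \<ge> i"
  then show "(\<Sum>n\<le>m. int_mult (z n) (a n)) = (\<Sum>n<i. int_mult (z n) (a n))"
    using assms by (intro sum.mono_neutral_right) auto
qed

text \<open>Coefficients bounded by \<open>g\<close> split into a head of finite support, which is
  always harmless, and a tail that is zero before \<open>i\<close> and hence bounded by
  \<open>f\<close> everywhere. The same \<open>a\<close> remains a witness.\<close>

lemma f_C_sums_eventually_le:
  assumes "f_C_sums f a" and le: "\<And>n. n \<ge> i \<Longrightarrow> g n \<le> f n"
  shows "f_C_sums g a"
  unfolding f_C_sums_def
proof (intro conjI allI impI)
  show "inj a"
    using assms(1) by (simp add: f_C_sums_def)
  fix z :: "nat \<Rightarrow> int"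
  assume z: "\<forall>n. enat (nat \<bar>z n\<bar>) \<le> g n"
  let ?head = "\<lambda>n. if n < i then z n else 0" and ?tail = "\<lambda>n. if n < i then 0 else z n"
  have "enat (nat \<bar>?tail n\<bar>) \<le> f n" for n
    using z le[of n] by (auto simp: zero_enat_def[symmetric] intro: order_trans)
  then have "C_sums ?tail a"
    using assms(1) by (simp add: f_C_sums_def)
  moreover have "C_sums ?head a"
    by (rule C_sums_finite_support[of i]) simp
  ultimately have "C_sums (\<lambda>n. ?head n + ?tail n) a"
    by (intro C_sums_add)
  moreover have "(\<lambda>n. ?head n + ?tail n) = z"
    by auto
  ultimately show "C_sums z a"
    by simp
qed

text \<open>Every \<open>f\<close> in \<open>W_inf\<close> is at least 1, so sign sequences are
  admissible coefficients. Induction on \<open>k\<close> peels off one sign sequence at a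
  time.\<close>

lemma f_C_sums_const:
  assumes "f_C_sums f a" and "f \<in> W_inf"
  shows "f_C_sums (\<lambda>_. enat k) a"
proof -
  have "C_sums z a" if "\<And>n. \<bar>z n\<bar> \<le> int k" for z
    using that
  proof (induction k arbitrary: z)
    case 0
    then show ?case
      by (intro C_sums_finite_support) simp
  next
    case (Suc k)
    have "enat (nat \<bar>sgn (z n)\<bar>) \<le> f n" for n
    proof -
      have "nat \<bar>sgn (z n)\<bar> \<le> 1"
        by (simp add: sgn_if)
      then have "enat (nat \<bar>sgn (z n)\<bar>) \<le> 1"
        by (simp add: one_enat_def)
      also have "1 \<le> f n"
        using assms(2) by (auto simp: W_inf_def one_eSuc ileI1 i0_less)
      finally show ?thesis .
    qed
    then have "C_sums (\<lambda>n. sgn (z n)) a"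
      using assms(1) by (simp add: f_C_sums_def)
    \<comment> \<open>Subtracting the sign moves a nonzero integer one step towards 0, which lowers
      the bound from \<open>Suc k\<close> to \<open>k\<close>.\<close>
    moreover have "\<bar>z n - sgn (z n)\<bar> \<le> int k" for n
      using Suc.prems[of n] by (auto simp: sgn_if)
    then have "C_sums (\<lambda>n. z n - sgn (z n)) a"
      by (rule Suc.IH)
    ultimately have "C_sums (\<lambda>n. sgn (z n) + (z n - sgn (z n))) a"
      by (rule C_sums_add)
    then show ?case
      by simp
  qed
  then show ?thesis
    using assms(1) by (simp add: f_C_sums_def nat_le_iff)
qed

text \<open>Coefficients for \<open>a \<circ> r\<close> are extended by zero to coefficients for
  \<open>a\<close>. The partial sums for \<open>a \<circ> r\<close> are then a subsequence, along
  \<open>r\<close>, of those for \<open>a\<close>.\<close>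

lemma f_C_sums_subsequence:
  assumes "f_C_sums f a" and r: "strict_mono r"
  shows "f_C_sums (f \<circ> r) (a \<circ> r)"
  unfolding f_C_sums_def
proof (intro conjI allI impI)
  have inj_r: "inj r"
    using r by (rule strict_mono_imp_inj_on)
  then show "inj (a \<circ> r)"
    using assms(1) by (simp add: f_C_sums_def inj_compose)
  fix z :: "nat \<Rightarrow> int"
  assume z: "\<forall>n. enat (nat \<bar>z n\<bar>) \<le> (f \<circ> r) n"
  define y where "y n = (if n \<in> range r then z (inv r n) else 0)" for n
  have y_r: "y (r j) = z j" for j
    using inj_r by (simp add: y_def)
  have "enat (nat \<bar>y n\<bar>) \<le> f n" for n
  proof (cases "n \<in> range r")
    case True
    with z show ?thesis
      by (auto simp: y_r)
  next
    case False
    then show ?thesis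
      by (simp add: y_def zero_enat_def[symmetric])
  qed
  then have "C (\<lambda>m. \<Sum>n\<le>m. int_mult (y n) (a n))"
    using assms(1) by (simp add: f_C_sums_def C_sums_def)
  then have "C ((\<lambda>m. \<Sum>n\<le>m. int_mult (y n) (a n)) \<circ> r)"
    using r by (rule subsequence)
  moreover have "(\<Sum>j\<le>m. int_mult (z j) (a (r j))) = (\<Sum>n\<le>r m. int_mult (y n) (a n))" for m
    using sum_subsequence[OF r, of "\<lambda>n. int_mult (y n) (a n)" m] by (simp add: y_def inj_r)
  ultimately show "C_sums z (a \<circ> r)"
    by (simp add: C_sums_def comp_def)
qed

section \<open>Lower bounds on \<open>P\<close> and the four cases\<close>

lemma star_closure_subset_P:
  assumes "A \<subseteq> P"
  shows "star_closure A \<subseteq> P"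
proof
  fix g assume "g \<in> star_closure A"
  then obtain f i where "g \<in> W_inf" "f \<in> A" and eq: "\<And>n. n \<ge> i \<Longrightarrow> g n = f n"
    by (auto simp: star_closure_def eq_star_def)
  with assms obtain a where "f_C_sums f a"
    by (auto simp: P_def)
  then have "f_C_sums g a"
    by (rule f_C_sums_eventually_le[where i = i]) (simp add: eq)
  with \<open>g \<in> W_inf\<close> show "g \<in> P"
    by (auto simp: P_def)
qed

lemma W_bdd_subset_P:
  assumes "f \<in> P"
  shows "W_bdd \<subseteq> P"
proof
  fix g assume "g \<in> W_bdd"
  then obtain k where "g \<in> W_inf" and k: "\<And>n. g n \<le> enat k"
    by (auto simp: W_bdd_def W_fin_def)
  moreover obtain a where "f_C_sums f a" "f \<in> W_inf"
    using assms by (auto simp: P_def)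
  then have "f_C_sums g a"
    using f_C_sums_eventually_le[OF f_C_sums_const[of f a k], of 0 g] k by simp
  ultimately show "g \<in> P"
    by (auto simp: P_def)
qed

text \<open>Each value \<open>h j\<close> is dominated by \<open>f\<close> at arbitrarily late
  indices, so some subsequence satisfies \<open>h \<le> f \<circ> r\<close> pointwise; the witness
  for \<open>f\<close> thinned out along \<open>r\<close> serves \<open>h\<close>.\<close>

lemma dominated_in_P:
  assumes "f \<in> P" and "h \<in> W_inf" and "\<And>j i. \<exists>n\<ge>i. h j \<le> f n"
  shows "h \<in> P"
proof -
  obtain r where "strict_mono r" and r: "\<And>j. h j \<le> f (r j)"
    using strict_mono_choice[of "\<lambda>j n. h j \<le> f n"] assms(3) by blast
  moreover obtain a where "f_C_sums f a"
    using assms(1) by (auto simp: P_def)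
  ultimately have "f_C_sums (f \<circ> r) (a \<circ> r)"
    by (intro f_C_sums_subsequence)
  then have "f_C_sums h (a \<circ> r)"
    by (rule f_C_sums_eventually_le) (simp add: r)
  with assms(2) show ?thesis
    by (auto simp: P_def)
qed

text \<open>If some \<open>h j\<close> were not reached by \<open>f\<close> beyond \<open>i\<close>,
  this finite value would bound the tail of \<open>f\<close>, making \<open>f\<close> almost
  bounded.\<close>

lemma W_fin_subset_P:
  assumes "f \<in> P" and "f \<notin> star_closure W_bdd"
  shows "W_fin \<subseteq> P"
proof
  fix h assume h: "h \<in> W_fin"
  have "\<exists>n\<ge>i. h j \<le> f n" for j i
  proof (rule ccontr)
    assume "\<not> (\<exists>n\<ge>i. h j \<le> f n)"
    then have "f n \<le> h j" if "n \<ge> i" for n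
      using that by (meson le_cases)
    moreover obtain k where "h j = enat k"
      using h by (auto simp: W_fin_def)
    ultimately have "f \<in> star_closure W_bdd"
      using assms(1) by (intro star_closure_W_bddI[of f i k]) (auto simp: P_def)
    with assms(2) show False ..
  qed
  moreover have "h \<in> W_inf"
    using h by (simp add: W_fin_def)
  ultimately show "h \<in> P"
    using dominated_in_P[OF assms(1)] by blast
qed

text \<open>Here \<open>f\<close> is infinite at arbitrarily late indices, and there it dominates
  any value of \<open>h\<close>.\<close>

lemma W_inf_subset_P:
  assumes "f \<in> P" and "f \<notin> star_closure W_fin"
  shows "W_inf \<subseteq> P"
proof
  fix h assume h: "h \<in> W_inf"
  have "\<exists>n\<ge>i. f n = \<infinity>" for i
    using assms star_closure_W_finI[of f i] unfolding P_def by (metis (lifting) mem_Collect_eq)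
  then have "\<exists>n\<ge>i. h j \<le> f n" for j i
    by (metis enat_ord_simps(3))
  with h show "h \<in> P"
    using dominated_in_P[OF assms(1)] by blast
qed

text \<open>The case split follows the chain of star closures. A single element of \<open>P\<close>,
  taken outside the next smaller closure in the last two cases, already forces the matching lower
  inclusion.\<close>

theorem P_cases: "P \<in> {{}, star_closure W_bdd, star_closure W_fin, W_inf}"
proof -
  have "P \<subseteq> W_inf"
    by (auto simp: P_def)
  consider "P = {}" | "P \<noteq> {}" "P \<subseteq> star_closure W_bdd"
    | "\<not> P \<subseteq> star_closure W_bdd" "P \<subseteq> star_closure W_fin"
    | "\<not> P \<subseteq> star_closure W_fin"
    by blast
  then show ?thesis
  proof cases
    case 2
    then have "star_closure W_bdd \<subseteq> P"
      using W_bdd_subset_P star_closure_subset_P by blast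
    with 2 show ?thesis by blast
  next
    case 3
    then have "star_closure W_fin \<subseteq> P"
      using W_fin_subset_P star_closure_subset_P by blast
    with 3 show ?thesis by blast
  next
    case 4
    then have "W_inf \<subseteq> P"
      using W_inf_subset_P by blast
    with \<open>P \<subseteq> W_inf\<close> show ?thesis by blast
  qed simp
qed

end

section \<open>The two instances: convergence and the Cauchy condition\<close>

lemma sequence_property_convergent:
  "sequence_property (convergent :: (nat \<Rightarrow> 'a::topological_ab_group_add) \<Rightarrow> bool)"
proof
  fix x y :: "nat \<Rightarrow> 'a"
  assume "convergent x" "convergent y"
  then show "convergent (\<lambda>n. x n + y n)"
    by (auto simp: convergent_def intro: tendsto_add)
next
  fix x :: "nat \<Rightarrow> 'a" and k c
  assume "\<And>n. n \<ge> k \<Longrightarrow> x n = c"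
  then have "x \<longlonglongrightarrow> c"
    by (intro tendsto_eventually) (auto simp: eventually_sequentially)
  then show "convergent x"
    by (auto simp: convergent_def)
next
  fix x :: "nat \<Rightarrow> 'a" and r :: "nat \<Rightarrow> nat"
  assume "convergent x" "strict_mono r"
  then show "convergent (x \<circ> r)"
    by (auto simp: convergent_def intro: LIMSEQ_subseq_LIMSEQ)
qed

lemma group_Cauchy_add:
  assumes "group_Cauchy x" and "group_Cauchy y"
  shows "group_Cauchy (\<lambda>n. x n + y n)"
  unfolding group_Cauchy_def
proof (intro allI impI)
  fix U :: "'a set"
  assume U: "\<forall>\<^sub>F y in nhds 0. y \<in> U"
  \<comment> \<open>Continuity of addition at (0, 0) provides neighbourhoods \<open>V\<close> and
    \<open>W\<close> of 0 whose sum lies in \<open>U\<close>.\<close>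
  have "((\<lambda>p::'a \<times> 'a. fst p + snd p) \<longlongrightarrow> 0 + 0) (nhds 0 \<times>\<^sub>F nhds 0)"
    by (rule tendsto_add_Pair)
  then have "\<forall>\<^sub>F p in nhds 0 \<times>\<^sub>F nhds 0. fst p + snd p \<in> U"
    using U by (auto simp: filterlim_iff)
  then obtain V W where V: "eventually V (nhds 0)" and W: "eventually W (nhds 0)"
    and VW: "\<And>v w. V v \<Longrightarrow> W w \<Longrightarrow> v + w \<in> U"
    by (auto simp: eventually_prod_filter)
  obtain k where k: "\<And>l m. l \<ge> k \<Longrightarrow> m \<ge> k \<Longrightarrow> V (x m - x l)"
    using assms(1)[unfolded group_Cauchy_def, rule_format, of "Collect V"] V by auto
  obtain k' where k': "\<And>l m. l \<ge> k' \<Longrightarrow> m \<ge> k' \<Longrightarrow> W (y m - y l)"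
    using assms(2)[unfolded group_Cauchy_def, rule_format, of "Collect W"] W by auto
  have "x m + y m - (x l + y l) \<in> U" if "l \<ge> max k k'" "m \<ge> max k k'" for l m
    using VW[OF k[of l m] k'[of l m]] that by (simp add: algebra_simps)
  then show "\<exists>k. \<forall>l\<ge>k. \<forall>m\<ge>k. x m + y m - (x l + y l) \<in> U"
    by blast
qed

lemma sequence_property_group_Cauchy:
  "sequence_property (group_Cauchy :: (nat \<Rightarrow> 'a::topological_ab_group_add) \<Rightarrow> bool)"
proof
  fix x y :: "nat \<Rightarrow> 'a"
  assume "group_Cauchy x" "group_Cauchy y"
  then show "group_Cauchy (\<lambda>n. x n + y n)"
    by (rule group_Cauchy_add)
next
  fix x :: "nat \<Rightarrow> 'a" and k c
  assume x: "\<And>n. n \<ge> k \<Longrightarrow> x n = c"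
  show "group_Cauchy x"
    unfolding group_Cauchy_def
  proof (intro allI impI)
    fix U :: "'a set"
    assume "\<forall>\<^sub>F y in nhds 0. y \<in> U"
    then have "0 \<in> U"
      by (rule eventually_nhds_x_imp_x)
    with x show "\<exists>k. \<forall>l\<ge>k. \<forall>m\<ge>k. x m - x l \<in> U"
      by (intro exI[of _ k]) simp
  qed
next
  fix x :: "nat \<Rightarrow> 'a" and r :: "nat \<Rightarrow> nat"
  assume "group_Cauchy x" "strict_mono r"
  then show "group_Cauchy (x \<circ> r)"
    \<comment> \<open>The same threshold \<open>k\<close> works, because \<open>n \<le> r n\<close>
      for strictly increasing \<open>r\<close>.\<close>
    unfolding group_Cauchy_def comp_def by (metis order_trans seq_suble)
qed

theorem corollary10p8:
  fixes G :: "'a::{topological_ab_group_add, t2_space} itself"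
  shows "P_set G \<in> {{}, star_closure W_bdd, star_closure W_fin, W_inf} \<and>
         PC_set G \<in> {{}, star_closure W_bdd, star_closure W_fin, W_inf}"
proof -
  interpret conv: sequence_property "convergent :: (nat \<Rightarrow> 'a) \<Rightarrow> bool"
    by (rule sequence_property_convergent)
  interpret Cauchy: sequence_property "group_Cauchy :: (nat \<Rightarrow> 'a) \<Rightarrow> bool"
    by (rule sequence_property_group_Cauchy)
  \<comment> \<open>\<open>summable\<close> refers to sums over \<open>n < m\<close>,
    \<open>C_sums\<close> to sums over \<open>n \<le> m\<close>;
    \<open>summable_iff_convergent'\<close> bridges this shift.\<close>
  have "P_set G = conv.P"
    by (simp add: P_set_def f_summable_def conv.P_def conv.f_C_sums_def conv.C_sums_def
        summable_iff_convergent')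
  moreover have "PC_set G = Cauchy.P"
    by (simp add: PC_set_def f_Cauchy_summable_def Cauchy_summable_def
        Cauchy.P_def Cauchy.f_C_sums_def Cauchy.C_sums_def)
  ultimately show ?thesis
    using conv.P_cases Cauchy.P_cases by simp
qed

end
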